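(* For the Online Vector Packing Problem, no (possibly randomized, computationally unbounded) online algorithm achieves a competitive ratio of $o\!\left(\frac{\log k}{\log\log k}\right)$, even when $f(S)=|S|$ and $\max_{u\in\Omega}\|\mathbf{w}_u\|_\infty$ is required to be at most an arbitrarily small prescribed positive number.
   Context: Online Vector Packing Problem: there is a $d$-dimensional knapsack with capacity $1$ in each dimension. Items $u\in\Omega$ arrive online in an arbitrary (adversarial) order; the algorithm does not know the number of items in advance. Each item $u$ has a weight vector $\mathbf{w}_u\in[0,1]^d$, revealed upon arrival. Upon arrival of $u$, the algorithm must immediately decide whether to accept or discard $u$; it may also dispose of previously accepted items at no cost (free disposal), but discarded or disposed-of items can never be recovered. The set $S$ of currently accepted items must always satisfy $\sum_{u\in S}\mathbf{w}_u\le \mathbf{1}$. The utility of a set $S$ is $f(S)$ for a non-negative monotone submodular function $f$. If $S$ is the final set kept, $\mathrm{ALG}=f(S)$, and the competitive ratio is the worst case over instances of $\mathrm{OPT}/\mathbb{E}[\mathrm{ALG}]$, where $\mathrm{OPT}$ is the maximum utility of a feasible subset of all arrived items. The sparsity $k$ is the minimum number such that every weight vector has at most $k$ non-zero coordinates. *)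

theory Defs
  imports "HOL-Probability.Probability" "HOL-Library.Landau_Symbols"
begin

text \<open>
  The items of an instance are named by their arrival position: item \<open>u\<close> is the
  \<open>u\<close>-th item to arrive (counting from \<open>0\<close>), so the list of weight vectors also fixes the
  arrival order.  Vectors of \<open>\<real>\<^sup>d\<close> are extensional functions on \<open>{..<d}\<close>.
\<close>

record ovp_instance =
  dim :: nat
  weights :: "(nat \<Rightarrow> real) list"
  utility :: "nat set \<Rightarrow> real"

definition items :: "ovp_instance \<Rightarrow> nat set" where
  "items I = {..<length (weights I)}"

definition submodular_on :: "'a set \<Rightarrow> ('a set \<Rightarrow> real) \<Rightarrow> bool" where
  "submodular_on U f \<longleftrightarrow>
     (\<forall>S\<subseteq>U. \<forall>T\<subseteq>U. f (S \<union> T) + f (S \<inter> T) \<le> f S + f T)"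

definition valid_instance :: "ovp_instance \<Rightarrow> bool" where
  "valid_instance I \<longleftrightarrow>
     set (weights I) \<subseteq> ({..<dim I} \<rightarrow>\<^sub>E {0..1}) \<and>
     (\<forall>S\<subseteq>items I. 0 \<le> utility I S) \<and>
     mono_on (Pow (items I)) (utility I) \<and>
     submodular_on (items I) (utility I)"

definition feasible :: "ovp_instance \<Rightarrow> nat set \<Rightarrow> bool" where
  "feasible I S \<longleftrightarrow> S \<subseteq> items I \<and> (\<forall>i<dim I. (\<Sum>u\<in>S. (weights I ! u) i) \<le> 1)"

definition opt :: "ovp_instance \<Rightarrow> real" where
  "opt I = Max (utility I ` {S. feasible I S})"

definition sparsity :: "ovp_instance \<Rightarrow> nat" where
  "sparsity I = (LEAST k. \<forall>w\<in>set (weights I). card {i. i < dim I \<and> w i \<noteq> 0} \<le> k)"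

text \<open>
  A randomized online algorithm draws a seed from an arbitrary probability space, after which it
  is deterministic: \<open>keep A \<omega> ws g\<close> is the set of items held once the items with weight vectors
  \<open>ws\<close> have arrived, where \<open>g\<close> is the utility function on the subsets of the arrived items.
  Earlier decisions need not be passed on, since they are determined by the seed and
  the prefixes of the input.
\<close>

record 's online_algorithm =
  seed :: "'s measure"
  keep :: "'s \<Rightarrow> (nat \<Rightarrow> real) list \<Rightarrow> (nat set \<Rightarrow> real) \<Rightarrow> nat set"

text \<open>
  The set held after the first \<open>t\<close> arrivals; it can depend only on what has been revealed by then,
  and in particular not on the total number of items.
\<close>

definition held :: "'s online_algorithm \<Rightarrow> ovp_instance \<Rightarrow> nat \<Rightarrow> 's \<Rightarrow> nat set" where
  "held A I t \<omega> = keep A \<omega> (take t (weights I)) (restrict (utility I) (Pow {..<t}))"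

text \<open>
  The inclusion below expresses irrevocable rejection together with free disposal: on the arrival of
  item \<open>t\<close> any of the held items may be dropped, and only \<open>t\<close> may be added.
\<close>

definition valid_algorithm :: "nat \<Rightarrow> 's online_algorithm \<Rightarrow> bool" where
  "valid_algorithm d A \<longleftrightarrow>
     prob_space (seed A) \<and>
     (\<forall>I. valid_instance I \<and> dim I = d \<longrightarrow>
        (\<forall>t\<le>length (weights I). held A I t \<in> seed A \<rightarrow>\<^sub>M count_space UNIV) \<and>
        (\<forall>\<omega>\<in>space (seed A).
           held A I 0 \<omega> = {} \<and>
           (\<forall>t<length (weights I). held A I (Suc t) \<omega> \<subseteq> insert t (held A I t \<omega>)) \<and>
           (\<forall>t\<le>length (weights I). feasible I (held A I t \<omega>))))"

definition expected_alg :: "'s online_algorithm \<Rightarrow> ovp_instance \<Rightarrow> real" where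
  "expected_alg A I =
     (\<integral>\<omega>. utility I (held A I (length (weights I)) \<omega>) \<partial>seed A)"

text \<open>
  The algorithm may be tailored to the dimension and to the sparsity.  The competitive ratio, as a
  function of the sparsity \<open>k\<close>, is the worst case over all instances of sparsity \<open>k\<close>, of any
  dimension, in the class \<open>C\<close>.  In \<^typ>\<open>ennreal\<close>, \<open>x / 0 = \<infinity>\<close> for \<open>x > 0\<close>, and \<open>0 / 0 = 0\<close>.
\<close>

definition competitive_ratio ::
    "(nat \<Rightarrow> nat \<Rightarrow> 's online_algorithm) \<Rightarrow> ovp_instance set \<Rightarrow> nat \<Rightarrow> ennreal" where
  "competitive_ratio A C k =
     (SUP I\<in>{I \<in> C. sparsity I = k}. ennreal (opt I) / ennreal (expected_alg (A (dim I) k) I))"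

definition small_cardinality_instances :: "real \<Rightarrow> ovp_instance set" where
  "small_cardinality_instances \<epsilon> =
     {I. valid_instance I \<and>
         (\<forall>S\<subseteq>items I. utility I S = real (card S)) \<and>
         (\<forall>w\<in>set (weights I). \<forall>i<dim I. \<bar>w i\<bar> \<le> \<epsilon>)}"

end

theory Submission
  imports Defs "HOL-Real_Asymp.Real_Asymp"
begin

text \<open>
  The dimensions are the words of length \<open>m\<close> over the alphabet \<open>{..<n}\<close>.  In phase \<open>i\<close> there arrive
  \<open>B\<close> items of each type \<open>v < n\<close>; having fixed \<open>g\<^sub>0, \<dots>, g\<^sub>i\<^sub>-\<^sub>1\<close>, the adversary gives them weight
  \<open>1 / B\<close> on the words that begin with \<open>g\<^sub>0 \<dots> g\<^sub>i\<^sub>-\<^sub>1\<close> and whose next letter is not \<open>v\<close>, and lets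
  \<open>g\<^sub>i\<close> be the type of which the algorithm holds the fewest items in expectation after the phase.
  Two words that differ at position \<open>i\<close> between them meet every item of phase \<open>i\<close>, so at most \<open>2B\<close>
  of these items are held, and at most \<open>2B / n\<close> of type \<open>g\<^sub>i\<close> in expectation.

  All items of the types \<open>g\<^sub>i\<close> fit together, because a word meets only those of the phase where it
  first deviates from \<open>g\<close>; this gives \<open>OPT \<ge> m B\<close>.  All other items meet the word \<open>g\<close>, so that
  \<open>ALG \<le> B + m (2B / n)\<close> in expectation.  With \<open>n = m\<close> the ratio is at least \<open>m / 3\<close>, while the
  sparsity \<open>k = (m - 1) m\<^sup>m\<^sup>-\<^sup>1\<close> satisfies \<open>ln k / ln (ln k) \<le> m\<close>.
\<close>

section \<open>The family of hard instances\<close>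

locale packing_adversary =
  fixes n m B :: nat and word :: "nat \<Rightarrow> nat \<Rightarrow> nat"
  assumes n_ge_2: "2 \<le> n" and m_pos: "0 < m" and B_pos: "0 < B"
    and bij_word: "bij_betw word {..<n ^ m} ({..<m} \<rightarrow>\<^sub>E {..<n})"
begin

text \<open>Arrival numbers are read as \<open>u = (i * B + b) * n + v\<close> with phase
  \<open>i\<close>, copy \<open>b < B\<close> and type \<open>v < n\<close>. Thus
  \<open>u mod n\<close> is the type, and \<open>u div n\<close> names the pair of phase and
  copy.\<close>

definition phase :: "nat \<Rightarrow> nat" where
  "phase u = u div n div B"

definition conflict :: "(nat \<Rightarrow> nat) \<Rightarrow> nat \<Rightarrow> nat \<Rightarrow> bool" where
  "conflict g u e \<longleftrightarrow> (\<forall>j<phase u. word e j = g j) \<and> word e (phase u) \<noteq> u mod n"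

definition weight :: "(nat \<Rightarrow> nat) \<Rightarrow> nat \<Rightarrow> nat \<Rightarrow> real" where
  "weight g u = (\<lambda>e\<in>{..<n ^ m}. if conflict g u e then 1 / real B else 0)"

definition inst :: "(nat \<Rightarrow> nat) \<Rightarrow> ovp_instance" where
  "inst g = \<lparr>dim = n ^ m, weights = map (weight g) [0..<m * B * n], utility = \<lambda>S. real (card S)\<rparr>"

lemma phase_less_iff: "phase u < i \<longleftrightarrow> u < i * B * n"
  using n_ge_2 B_pos by (simp add: phase_def div_less_iff_less_mult)

lemma inst_simps [simp]:
  "dim (inst g) = n ^ m" "length (weights (inst g)) = m * B * n"
  "utility (inst g) S = real (card S)" "items (inst g) = {..<m * B * n}"
  by (simp_all add: inst_def items_def)

lemma weights_inst_nth [simp]: "u < m * B * n \<Longrightarrow> weights (inst g) ! u = weight g u"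
  by (simp add: inst_def)

lemma set_weights_inst: "set (weights (inst g)) = weight g ` {..<m * B * n}"
  by (auto simp: inst_def)

section \<open>Feasible sets, sparsity and optimum\<close>

lemma valid_inst: "valid_instance (inst g)"
proof -
  have "mono_on (Pow {..<m * B * n}) (\<lambda>S. real (card S))"
    by (auto intro!: mono_onI card_mono finite_subset[of _ "{..<m * B * n}"])
  moreover have "real (card (S \<union> T)) + real (card (S \<inter> T)) \<le> real (card S) + real (card T)"
    if "S \<subseteq> {..<m * B * n}" "T \<subseteq> {..<m * B * n}" for S T
    using card_Un_Int[of S T] that by (simp add: finite_subset)
  moreover have "weight g u \<in> {..<n ^ m} \<rightarrow>\<^sub>E {0..1}" for u
    using B_pos by (auto simp: weight_def)
  moreover have "utility (inst g) = (\<lambda>S. real (card S))"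
    by (simp add: inst_def)
  ultimately show ?thesis
    by (auto simp: valid_instance_def set_weights_inst submodular_on_def)
qed

text \<open>All non-zero weights equal \<open>1 / B\<close>, so capacity 1 in coordinate
  \<open>e\<close> only limits how many items conflict with \<open>e\<close>.\<close>

lemma feasible_inst_iff:
  "feasible (inst g) S \<longleftrightarrow>
     S \<subseteq> {..<m * B * n} \<and> (\<forall>e<n ^ m. card {u\<in>S. conflict g u e} \<le> B)"
proof -
  have "(\<Sum>u\<in>S. (weights (inst g) ! u) e) = real (card {u\<in>S. conflict g u e}) / real B"
    if S: "S \<subseteq> {..<m * B * n}" and e: "e < n ^ m" for e
  proof -
    have fin: "finite S"
      using S finite_subset by blast
    have "(\<Sum>u\<in>S. (weights (inst g) ! u) e) = (\<Sum>u\<in>S. if conflict g u e then 1 / real B else 0)"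
      using S e by (intro sum.cong) (auto simp: weight_def)
    also have "\<dots> = (\<Sum>u\<in>{u\<in>S. conflict g u e}. 1 / real B)"
      using fin by (rule sum.inter_filter[symmetric])
    finally show ?thesis by simp
  qed
  then show ?thesis
    using B_pos by (auto simp: feasible_def)
qed

lemma obtain_dimension:
  assumes "\<And>j. j < m \<Longrightarrow> h j < n"
  obtains e where "e < n ^ m" "\<And>j. j < m \<Longrightarrow> word e j = h j"
proof -
  have "restrict h {..<m} \<in> word ` {..<n ^ m}"
    using assms bij_word by (auto simp: bij_betw_def)
  then obtain e where "e < n ^ m" "word e = restrict h {..<m}" by auto
  then show thesis using that by auto
qed

text \<open>Only the letters before position \<open>i\<close> have to be legal, because the bound is
  applied while \<open>g i\<close> is still to be chosen.\<close>

lemma card_phase_le: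
  assumes S: "feasible (inst g) S" and i: "i < m" and g: "\<And>j. j < i \<Longrightarrow> g j < n"
  shows "card {u\<in>S. phase u = i} \<le> 2 * B"
proof -
  have "\<exists>e<n ^ m. (\<forall>j<i. word e j = g j) \<and> word e i = v" if "v < n" for v
  proof -
    have "(if j < i then g j else v) < n" for j
      using that g by simp
    then obtain e where "e < n ^ m" "\<And>j. j < m \<Longrightarrow> word e j = (if j < i then g j else v)"
      using obtain_dimension[of "\<lambda>j. if j < i then g j else v"] by blast
    then show ?thesis using i by auto
  qed
  \<comment> \<open>No type equals both letters 0 and 1, so each item of phase \<open>i\<close>
    conflicts with \<open>e0\<close> or \<open>e1\<close>.\<close>
  from this[of 0] this[of 1]
  obtain e0 e1 where e: "e0 < n ^ m" "\<And>j. j < i \<Longrightarrow> word e0 j = g j" "word e0 i = 0"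
      "e1 < n ^ m" "\<And>j. j < i \<Longrightarrow> word e1 j = g j" "word e1 i = 1"
    using n_ge_2 by auto
  have fin: "finite S"
    using S finite_subset by (auto simp: feasible_inst_iff)
  have "{u\<in>S. phase u = i} \<subseteq> {u\<in>S. conflict g u e0} \<union> {u\<in>S. conflict g u e1}"
    using e by (auto simp: conflict_def)
  then have "card {u\<in>S. phase u = i} \<le> card ({u\<in>S. conflict g u e0} \<union> {u\<in>S. conflict g u e1})"
    using fin by (intro card_mono) auto
  also have "\<dots> \<le> card {u\<in>S. conflict g u e0} + card {u\<in>S. conflict g u e1}"
    by (rule card_Un_le)
  also have "\<dots> \<le> B + B"
    using S e by (intro add_mono) (auto simp: feasible_inst_iff)
  finally show ?thesis by simp
qed

text \<open>The maximum is attained in phase 0, where an item meets every word whose first letter is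
  not its type. Items of later phases meet only words that begin with \<open>g 0\<close>; these
  avoid any other first letter \<open>v\<close>, so there are no more of them.\<close>

lemma sparsity_inst:
  assumes g: "g 0 < n"
  shows "sparsity (inst g) = (n - 1) * n ^ (m - 1)"
proof -
  let ?c = "\<lambda>w :: nat \<Rightarrow> real. card {e. e < dim (inst g) \<and> w e \<noteq> 0}"
  have supp: "{e. e < dim (inst g) \<and> weight g u e \<noteq> 0} = {e. e < n ^ m \<and> conflict g u e}" for u
    using B_pos by (auto simp: weight_def)
  have first: "card {e. e < n ^ m \<and> word e 0 \<noteq> v} = (n - 1) * n ^ (m - 1)" if v: "v < n" for v
  proof -
    have "word ` {e. e < n ^ m \<and> word e 0 \<noteq> v} = {h \<in> word ` {..<n ^ m}. h 0 \<noteq> v}"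
      by auto
    also have "\<dots> = {h \<in> {..<m} \<rightarrow>\<^sub>E {..<n}. h 0 \<noteq> v}"
      using bij_word by (simp add: bij_betw_def)
    also have "\<dots> = Pi\<^sub>E {..<m} (\<lambda>j. if j = 0 then {..<n} - {v} else {..<n})"
    proof (intro set_eqI iffI)
      fix h assume "h \<in> {h \<in> {..<m} \<rightarrow>\<^sub>E {..<n}. h 0 \<noteq> v}"
      then show "h \<in> Pi\<^sub>E {..<m} (\<lambda>j. if j = 0 then {..<n} - {v} else {..<n})"
        by (auto simp: PiE_iff)
    next
      fix h assume h: "h \<in> Pi\<^sub>E {..<m} (\<lambda>j. if j = 0 then {..<n} - {v} else {..<n})"
      then have "h j \<in> (if j = 0 then {..<n} - {v} else {..<n})" if "j < m" for j
        using that by (auto simp: PiE_iff)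
      then show "h \<in> {h \<in> {..<m} \<rightarrow>\<^sub>E {..<n}. h 0 \<noteq> v}"
        using h m_pos by (force simp: PiE_iff split: if_splits)
    qed
    finally have image: "word ` {e. e < n ^ m \<and> word e 0 \<noteq> v} = \<dots>" .
    have "inj_on word {e. e < n ^ m \<and> word e 0 \<noteq> v}"
      by (rule inj_on_subset[OF bij_betw_imp_inj_on[OF bij_word]]) auto
    then have "card {e. e < n ^ m \<and> word e 0 \<noteq> v} =
        card (Pi\<^sub>E {..<m} (\<lambda>j. if j = 0 then {..<n} - {v} else {..<n}))"
      by (simp only: card_image flip: image)
    also have "\<dots> = (\<Prod>j<m. if j = 0 then n - 1 else n)"
      using v by (auto simp: card_PiE intro!: prod.cong)
    also have "\<dots> = (n - 1) * (\<Prod>j<m - 1. n)"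
      using m_pos by (cases m) (simp_all add: prod.lessThan_Suc_shift del: prod.lessThan_Suc)
    finally show ?thesis by simp
  qed
  have upper: "?c (weight g u) \<le> (n - 1) * n ^ (m - 1)" for u
  proof (cases "phase u = 0")
    case True
    then show ?thesis
      using first[of "u mod n"] n_ge_2 by (simp add: supp[unfolded inst_simps] conflict_def)
  next
    case False
    obtain v where v: "v < n" "v \<noteq> g 0"
      using n_ge_2 that[of 0] that[of 1] by linarith
    have "{e. e < n ^ m \<and> conflict g u e} \<subseteq> {e. e < n ^ m \<and> word e 0 \<noteq> v}"
      using False v by (auto simp: conflict_def)
    then have "card {e. e < n ^ m \<and> conflict g u e} \<le> card {e. e < n ^ m \<and> word e 0 \<noteq> v}"
      by (intro card_mono) auto
    then show ?thesis using first[OF v(1)] by (simp add: supp[unfolded inst_simps])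
  qed
  have "phase 0 = 0" by (simp add: phase_def)
  then have attained: "?c (weight g 0) = (n - 1) * n ^ (m - 1)"
    using first[of 0] n_ge_2 by (simp add: supp[unfolded inst_simps] conflict_def)
  have mem: "weight g 0 \<in> set (weights (inst g))"
    using m_pos B_pos n_ge_2 by (auto simp: set_weights_inst)
  show ?thesis
    unfolding sparsity_def
  proof (rule Least_equality)
    show "\<forall>w\<in>set (weights (inst g)). ?c w \<le> (n - 1) * n ^ (m - 1)"
      using upper unfolding set_weights_inst by blast
    fix l assume "\<forall>w\<in>set (weights (inst g)). ?c w \<le> l"
    then show "(n - 1) * n ^ (m - 1) \<le> l"
      using mem attained by metis
  qed
qed

lemma opt_inst_ge:
  assumes g: "\<And>i. i < m \<Longrightarrow> g i < n"
  shows "real (m * B) \<le> opt (inst g)"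
proof -
  \<comment> \<open>From each group of \<open>n\<close> items with the same phase and copy, numbered
    by \<open>q\<close>, the item of type \<open>g (q div B)\<close> is taken.\<close>
  define S where "S = (\<lambda>q. q * n + g (q div B)) ` {..<m * B}"
  have lt: "g (q div B) < n" if "q < m * B" for q
    using that g less_mult_imp_div_less by blast
  have S_iff: "u < m * B * n \<and> u mod n = g (phase u)" if "u \<in> S" for u
  proof -
    obtain q where q: "q < m * B" "u = q * n + g (q div B)"
      using \<open>u \<in> S\<close> by (auto simp: S_def)
    have "phase u = q div B" "u mod n = g (q div B)"
      using lt[OF q(1)] q(2) by (simp_all add: phase_def)
    then show ?thesis
      using q(1) phase_less_iff[of u m] less_mult_imp_div_less by auto
  qed
  have S_inj: "u = u'" if "u \<in> S" "u' \<in> S" "u div n = u' div n" for u u'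
    using that S_iff by (metis phase_def div_mod_decomp)
  have "inj_on (\<lambda>q. q * n + g (q div B)) {..<m * B}"
  proof (rule inj_on_inverseI[where g = "\<lambda>u. u div n"])
    fix q assume "q \<in> {..<m * B}"
    then show "(q * n + g (q div B)) div n = q" using lt[of q] by simp
  qed
  then have card_S: "card S = m * B"
    unfolding S_def by (simp add: card_image)
  have "card {u\<in>S. conflict g u e} \<le> B" for e
  proof -
    \<comment> \<open>An item of \<open>S\<close> conflicts with \<open>e\<close> only if its phase
      is the first position where \<open>word e\<close> differs from \<open>g\<close>, and this
      position does not depend on the item.\<close>
    have *: "phase u = phase u'" if "u \<in> S" "u' \<in> S" "conflict g u e" "conflict g u' e" for u u'
      using that S_iff unfolding conflict_def by (metis linorder_neqE_nat)
    have "\<exists>i. {u\<in>S. conflict g u e} \<subseteq> {u\<in>S. phase u = i}"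
      using * by (cases "{u\<in>S. conflict g u e} = {}") blast+
    then obtain i where i: "{u\<in>S. conflict g u e} \<subseteq> {u\<in>S. phase u = i}" by blast
    \<comment> \<open>\<open>S\<close> has one item for each value of \<open>u div n\<close>, and a
      phase has \<open>B\<close> such values.\<close>
    have "card {u\<in>S. conflict g u e} = card ((\<lambda>u. u div n) ` {u\<in>S. conflict g u e})"
      by (intro card_image[symmetric] inj_onI) (auto intro: S_inj)
    also have "\<dots> \<le> card {i * B..<i * B + B}"
    proof (intro card_mono subsetI)
      fix q assume "q \<in> (\<lambda>u. u div n) ` {u\<in>S. conflict g u e}"
      then have "q div B = i" using i by (auto simp: phase_def)
      then show "q \<in> {i * B..<i * B + B}"
        using B_pos dividend_less_div_times[of B q] by auto
    qed simp
    finally show ?thesis by simp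
  qed
  then have "feasible (inst g) S"
    using S_iff by (auto simp: feasible_inst_iff)
  moreover have "finite {S. feasible (inst g) S}"
    by (rule finite_subset[of _ "Pow {..<m * B * n}"]) (auto simp: feasible_def)
  ultimately have "utility (inst g) S \<le> opt (inst g)"
    unfolding opt_def by (intro Max_ge) auto
  then show ?thesis using card_S by simp
qed

section \<open>The adaptive choice of \<open>g\<close> against the algorithm\<close>

text \<open>The weights of phase \<open>i\<close> involve only letters before position
  \<open>i\<close>. What the algorithm holds after that phase is therefore settled before
  \<open>g i\<close> is chosen, and the adversary may choose \<open>g i\<close> in response.\<close>

lemma held_inst_cong:
  assumes "\<And>j. j < i \<Longrightarrow> g j = g' j"
  shows "held A (inst g) (Suc i * B * n) = held A (inst g') (Suc i * B * n)"
proof -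
  have "weight g u = weight g' u" if "u < Suc i * B * n" for u
  proof -
    have "phase u < Suc i" using that by (simp only: phase_less_iff)
    then have "conflict g u e = conflict g' u e" for e
      using assms by (auto simp: conflict_def)
    then show ?thesis by (auto simp: weight_def)
  qed
  then have "take (Suc i * B * n) (weights (inst g)) = take (Suc i * B * n) (weights (inst g'))"
    unfolding inst_def ovp_instance.simps take_map
    by (intro map_cong) (auto simp: in_set_conv_nth simp del: mult_Suc)
  then show ?thesis by (simp add: fun_eq_iff held_def inst_def del: mult_Suc)
qed

text \<open>The count is taken right after phase \<open>i\<close> and not at the end, since later
  arrivals depend on \<open>g i\<close>.\<close>

definition held_type :: "'s online_algorithm \<Rightarrow> (nat \<Rightarrow> nat) \<Rightarrow> nat \<Rightarrow> nat \<Rightarrow> 's \<Rightarrow> nat set" where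
  "held_type A g i v \<omega> =
     {u \<in> held A (inst g) (Suc i * B * n) \<omega>. phase u = i \<and> u mod n = v}"

context
  fixes A :: "'s online_algorithm"
  assumes valid: "valid_algorithm (n ^ m) A"
begin

interpretation prob_space "seed A"
  using valid by (simp add: valid_algorithm_def)

lemma
  assumes "t \<le> m * B * n"
  shows held_measurable: "held A (inst g) t \<in> seed A \<rightarrow>\<^sub>M count_space UNIV"
    and held_feasible: "\<omega> \<in> space (seed A) \<Longrightarrow> feasible (inst g) (held A (inst g) t \<omega>)"
  using valid valid_inst[of g] assms by (auto simp: valid_algorithm_def)

lemma held_finite:
  "t \<le> m * B * n \<Longrightarrow> \<omega> \<in> space (seed A) \<Longrightarrow> finite (held A (inst g) t \<omega>)"
  using held_feasible[of t \<omega> g] finite_subset by (auto simp: feasible_inst_iff)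

text \<open>Each arrival adds at most itself, so an older item cannot return once dropped. This
  relates the final set to what was held right after each phase.\<close>

lemma held_mono:
  assumes "t \<le> t'" "t' \<le> m * B * n" "\<omega> \<in> space (seed A)"
  shows "held A (inst g) t' \<omega> \<inter> {..<t} \<subseteq> held A (inst g) t \<omega>"
  using assms(1,2)
proof (induction t' rule: dec_induct)
  case (step t')
  have "held A (inst g) (Suc t') \<omega> \<subseteq> insert t' (held A (inst g) t' \<omega>)"
    using valid valid_inst[of g] assms(3) step by (auto simp: valid_algorithm_def)
  then show ?case using step by auto
qed simp

lemma integrable_card_held:
  assumes "t \<le> m * B * n"
  shows "integrable (seed A) (\<lambda>\<omega>. real (card {u \<in> held A (inst g) t \<omega>. P u}))"
proof (rule integrable_const_bound[where B = "real (m * B * n)"])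
  have "card {u \<in> held A (inst g) t \<omega>. P u} \<le> m * B * n" if "\<omega> \<in> space (seed A)" for \<omega>
  proof -
    have "{u \<in> held A (inst g) t \<omega>. P u} \<subseteq> {..<m * B * n}"
      using held_feasible[OF assms that, of g] by (auto simp: feasible_inst_iff)
    from card_mono[OF _ this] show ?thesis by simp
  qed
  then show "AE \<omega> in seed A. norm (real (card {u \<in> held A (inst g) t \<omega>. P u})) \<le> real (m * B * n)"
    by (intro AE_I2) (simp only: real_norm_def abs_of_nat of_nat_le_iff)
  show "(\<lambda>\<omega>. real (card {u \<in> held A (inst g) t \<omega>. P u})) \<in> borel_measurable (seed A)"
    by (rule measurable_compose[OF held_measurable[OF assms]]) simp
qed

text \<open>Averaging: the types partition the at most \<open>2 * B\<close> items of phase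
  \<open>i\<close> that are held after it, so the \<open>n\<close> expectations sum to at most
  \<open>2 * B\<close>.\<close>

lemma exists_rarely_held_type:
  assumes i: "i < m" and g: "\<And>j. j < i \<Longrightarrow> g j < n"
  shows "\<exists>v<n. expectation (\<lambda>\<omega>. real (card (held_type A g i v \<omega>))) \<le> 2 * real B / real n"
proof (rule ccontr)
  assume "\<not> ?thesis"
  then have gt: "2 * real B / real n < expectation (\<lambda>\<omega>. real (card (held_type A g i v \<omega>)))"
    if "v < n" for v
    using that by force
  have t: "Suc i * B * n \<le> m * B * n"
    using i by (intro mult_le_mono1) simp
  have int: "integrable (seed A) (\<lambda>\<omega>. real (card (held_type A g i v \<omega>)))" for v
    unfolding held_type_def by (rule integrable_card_held[OF t])
  have "(\<Sum>v<n. real (card (held_type A g i v \<omega>))) \<le> 2 * real B" if \<omega>: "\<omega> \<in> space (seed A)" for \<omega>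
  proof -
    let ?H = "{u \<in> held A (inst g) (Suc i * B * n) \<omega>. phase u = i}"
    have "finite ?H" using held_finite[OF t \<omega>] by simp
    then have "(\<Sum>v<n. card {u\<in>?H. u mod n = v}) = card ?H"
      using n_ge_2 sum.group[of ?H "{..<n}" "\<lambda>u. u mod n" "\<lambda>_. 1::nat"] by force
    moreover have "held_type A g i v \<omega> = {u\<in>?H. u mod n = v}" for v
      by (auto simp: held_type_def)
    ultimately have "(\<Sum>v<n. card (held_type A g i v \<omega>)) \<le> 2 * B"
      using card_phase_le[OF held_feasible[OF t \<omega>] i g] by simp
    then have "real (\<Sum>v<n. card (held_type A g i v \<omega>)) \<le> real (2 * B)"
      by (rule of_nat_mono)
    then show ?thesis by simp
  qed
  then have "expectation (\<lambda>\<omega>. \<Sum>v<n. real (card (held_type A g i v \<omega>)))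
      \<le> expectation (\<lambda>_. 2 * real B)"
    by (intro integral_mono) (simp_all add: int)
  then have "(\<Sum>v<n. expectation (\<lambda>\<omega>. real (card (held_type A g i v \<omega>)))) \<le> 2 * real B"
    by (simp add: int prob_space)
  moreover have "(\<Sum>v<n. 2 * real B / real n)
      < (\<Sum>v<n. expectation (\<lambda>\<omega>. real (card (held_type A g i v \<omega>))))"
    using n_ge_2 gt by (intro sum_strict_mono) (auto simp: lessThan_empty_iff)
  ultimately show False using n_ge_2 by simp
qed

text \<open>The letters are picked by expectations and not by the outcome of the seed, so a single
  fixed instance works against the randomized algorithm.\<close>

lemma exists_adversarial_word:
  "\<exists>g. \<forall>i<m. g i < n \<and>
     expectation (\<lambda>\<omega>. real (card (held_type A g i (g i) \<omega>))) \<le> 2 * real B / real n"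
proof -
  let ?P = "\<lambda>g i. g i < n \<and>
     expectation (\<lambda>\<omega>. real (card (held_type A g i (g i) \<omega>))) \<le> 2 * real B / real n"
  have "\<exists>g. \<forall>i<l. ?P g i" if "l \<le> m" for l
    using that
  proof (induction l)
    case (Suc l)
    then obtain g where g: "\<forall>i<l. ?P g i" by auto
    then obtain v where v: "v < n"
      "expectation (\<lambda>\<omega>. real (card (held_type A g l v \<omega>))) \<le> 2 * real B / real n"
      using exists_rarely_held_type[of l g] Suc.prems by auto
    \<comment> \<open>The case \<open>i = l\<close> is included, because the items of phase
      \<open>l\<close> do not involve the letter at position \<open>l\<close>.\<close>
    have "held_type A (g(l := v)) i = held_type A g i" if "i \<le> l" for i
      using that held_inst_cong[of i "g(l := v)" g A] by (auto simp: held_type_def fun_eq_iff)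
    then have "?P (g(l := v)) i" if "i < Suc l" for i
      using that g v by (cases "i = l") auto
    then show ?case by blast
  qed simp
  then show ?thesis by blast
qed

text \<open>A held item either conflicts with the coordinate that spells \<open>g\<close>, which has
  room for \<open>B\<close> such items, or has type \<open>g (phase u)\<close> and was already held
  right after its phase. The bound holds for every seed.\<close>

lemma card_held_le:
  assumes \<omega>: "\<omega> \<in> space (seed A)" and g: "\<And>i. i < m \<Longrightarrow> g i < n"
  shows "card (held A (inst g) (m * B * n) \<omega>) \<le> B + (\<Sum>i<m. card (held_type A g i (g i) \<omega>))"
proof -
  let ?H = "held A (inst g) (m * B * n) \<omega>"
  have feas: "feasible (inst g) ?H"
    using held_feasible[OF _ \<omega>] by simp
  have fin: "finite (held_type A g i v \<omega>)" if "i < m" for i v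
    using that held_finite[OF _ \<omega>, of "Suc i * B * n" g] by (simp add: held_type_def mult_le_mono1 del: mult_Suc)
  have finH: "finite ?H" using held_finite[OF _ \<omega>] by simp
  obtain e where e: "e < n ^ m" "\<And>j. j < m \<Longrightarrow> word e j = g j"
    using obtain_dimension g by blast
  have "?H \<subseteq> {u\<in>?H. conflict g u e} \<union> (\<Union>i<m. held_type A g i (g i) \<omega>)"
  proof
    fix u assume u: "u \<in> ?H"
    then have ph: "phase u < m"
      using feas by (auto simp: feasible_inst_iff phase_less_iff)
    show "u \<in> {u\<in>?H. conflict g u e} \<union> (\<Union>i<m. held_type A g i (g i) \<omega>)"
    proof (cases "u mod n = g (phase u)")
      case True
      have "u < Suc (phase u) * B * n"
        using phase_less_iff[of u "Suc (phase u)"] by blast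
      moreover have "Suc (phase u) * B * n \<le> m * B * n"
        using ph by (intro mult_le_mono1) simp
      ultimately have "u \<in> held A (inst g) (Suc (phase u) * B * n) \<omega>"
        using held_mono[OF _ _ \<omega>, of "Suc (phase u) * B * n" "m * B * n" g] u by blast
      then show ?thesis using True ph by (auto simp: held_type_def)
    next
      case False
      then show ?thesis using u ph e(2) by (auto simp: conflict_def)
    qed
  qed
  then have "card ?H \<le> card ({u\<in>?H. conflict g u e} \<union> (\<Union>i<m. held_type A g i (g i) \<omega>))"
    using fin finH by (intro card_mono) auto
  also have "\<dots> \<le> card {u\<in>?H. conflict g u e} + card (\<Union>i<m. held_type A g i (g i) \<omega>)"
    by (rule card_Un_le)
  also have "\<dots> \<le> B + (\<Sum>i<m. card (held_type A g i (g i) \<omega>))"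
    using feas e(1) by (intro add_mono card_UN_le) (auto simp: feasible_inst_iff)
  finally show ?thesis .
qed

lemma exists_bad_instance:
  "\<exists>g. (\<forall>i<m. g i < n) \<and> expected_alg A (inst g) \<le> real B + real m * (2 * real B / real n)"
proof -
  obtain g where g: "\<And>i. i < m \<Longrightarrow> g i < n"
    and E: "\<And>i. i < m \<Longrightarrow>
      expectation (\<lambda>\<omega>. real (card (held_type A g i (g i) \<omega>))) \<le> 2 * real B / real n"
    using exists_adversarial_word by blast
  have int: "integrable (seed A) (\<lambda>\<omega>. real (card (held_type A g i v \<omega>)))" if "i < m" for i v
    unfolding held_type_def using that by (intro integrable_card_held mult_le_mono1) simp
  then have int_sum: "integrable (seed A) (\<lambda>\<omega>. \<Sum>i<m. real (card (held_type A g i (g i) \<omega>)))"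
    by (intro Bochner_Integration.integrable_sum) simp
  have "expected_alg A (inst g) = expectation (\<lambda>\<omega>. real (card (held A (inst g) (m * B * n) \<omega>)))"
    by (simp add: expected_alg_def)
  also have "\<dots> \<le> expectation (\<lambda>\<omega>. real B + (\<Sum>i<m. real (card (held_type A g i (g i) \<omega>))))"
  proof (rule integral_mono)
    show "integrable (seed A) (\<lambda>\<omega>. real (card (held A (inst g) (m * B * n) \<omega>)))"
      using integrable_card_held[of "m * B * n" g "\<lambda>_. True"] by simp
    show "integrable (seed A) (\<lambda>\<omega>. real B + (\<Sum>i<m. real (card (held_type A g i (g i) \<omega>))))"
      using int_sum by simp
    fix \<omega> assume "\<omega> \<in> space (seed A)"
    from of_nat_mono[OF card_held_le[OF this g], where 'a = real]
    show "real (card (held A (inst g) (m * B * n) \<omega>))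
        \<le> real B + (\<Sum>i<m. real (card (held_type A g i (g i) \<omega>)))" by simp
  qed
  also have "\<dots> = real B + (\<Sum>i<m. expectation (\<lambda>\<omega>. real (card (held_type A g i (g i) \<omega>))))"
    using int int_sum
    by (simp add: Bochner_Integration.integral_sum prob_space)
  also have "\<dots> \<le> real B + (\<Sum>i<m. 2 * real B / real n)"
    using E by (intro add_left_mono sum_mono) auto
  finally show ?thesis using g by auto
qed

end

end

section \<open>From the instances to the competitive ratio\<close>

lemma inverse_antimono_ennreal: "x \<le> y \<Longrightarrow> inverse y \<le> inverse (x :: ennreal)"
  by (simp add: less_eq_ennreal.rep_eq inverse_ennreal.rep_eq ereal_inverse_antimono)

lemma divide_mono_ennreal: "a \<le> b \<Longrightarrow> d \<le> c \<Longrightarrow> a / c \<le> b / (d :: ennreal)"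
  unfolding divide_ennreal_def by (intro mult_mono inverse_antimono_ennreal) auto

lemma competitive_ratio_ge:
  fixes A :: "nat \<Rightarrow> nat \<Rightarrow> 's online_algorithm"
  assumes "\<epsilon> > 0" and "\<And>d k. valid_algorithm d (A d k)" and m: "2 \<le> m"
  shows "ennreal (real m / 3) \<le>
    competitive_ratio A (small_cardinality_instances \<epsilon>) ((m - 1) * m ^ (m - 1))"
proof -
  \<comment> \<open>\<open>B\<close> is so large that the weight \<open>1 / B\<close> is at most
    \<open>\<epsilon>\<close>.\<close>
  define B where "B = Suc (nat \<lceil>1 / \<epsilon>\<rceil>)"
  have "1 / \<epsilon> \<le> real B" unfolding B_def by linarith
  moreover have "0 < B" by (simp add: B_def)
  ultimately have B: "0 < B" "1 / real B \<le> \<epsilon>"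
    using \<open>\<epsilon> > 0\<close> by (simp_all add: field_simps)
  have "finite ({..<m} \<rightarrow>\<^sub>E {..<m})" "card {..<m ^ m} = card ({..<m} \<rightarrow>\<^sub>E {..<m})"
    by (auto simp: finite_PiE card_PiE)
  then obtain word where "bij_betw word {..<m ^ m} ({..<m} \<rightarrow>\<^sub>E {..<m})"
    using finite_same_card_bij[of "{..<m ^ m}"] by blast
  then interpret packing_adversary m m B word
    using m B by unfold_locales auto
  let ?k = "(m - 1) * m ^ (m - 1)"
  \<comment> \<open>With \<open>n = m\<close> the bound on the algorithm becomes
    \<open>B + m * (2 * B / m) = 3 * B\<close>.\<close>
  obtain g where g: "\<And>i. i < m \<Longrightarrow> g i < m"
    and E: "expected_alg (A (m ^ m) ?k) (inst g) \<le> 3 * real B"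
    using exists_bad_instance[OF assms(2)[of "m ^ m" ?k]] m by (auto simp: field_simps)
  have "inst g \<in> small_cardinality_instances \<epsilon>"
    using valid_inst[of g] B \<open>\<epsilon> > 0\<close>
    by (auto simp: small_cardinality_instances_def set_weights_inst weight_def)
  moreover have "sparsity (inst g) = ?k"
    using g m by (intro sparsity_inst) auto
  ultimately have ratio: "ennreal (opt (inst g)) / ennreal (expected_alg (A (m ^ m) ?k) (inst g))
      \<le> competitive_ratio A (small_cardinality_instances \<epsilon>) ?k"
    unfolding competitive_ratio_def by (intro SUP_upper2[of "inst g"]) auto
  have "ennreal (real m / 3) = ennreal (real (m * B)) / ennreal (3 * real B)"
    using B by (subst divide_ennreal) auto
  \<comment> \<open>This covers an expected value of 0 as well: the optimum is positive, so the
    quotient is then infinite.\<close>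
  also have "\<dots> \<le> ennreal (opt (inst g)) / ennreal (expected_alg (A (m ^ m) ?k) (inst g))"
    using opt_inst_ge[of g] g E by (intro divide_mono_ennreal ennreal_leI) auto
  finally show ?thesis using ratio by (rule order_trans)
qed

section \<open>Asymptotics in the sparsity\<close>

theorem theorem1p4:
  fixes \<epsilon> :: real
    and A :: "nat \<Rightarrow> nat \<Rightarrow> 's online_algorithm"
    and r :: "nat \<Rightarrow> real"
  assumes "\<epsilon> > 0"
    and "\<And>d k. valid_algorithm d (A d k)"
    and "r \<in> o(\<lambda>k. ln (real k) / ln (ln (real k)))"
  shows "\<not> (\<forall>\<^sub>F k in sequentially.
            competitive_ratio A (small_cardinality_instances \<epsilon>) k \<le> ennreal (r k))"
proof
  assume "\<forall>\<^sub>F k in sequentially.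
            competitive_ratio A (small_cardinality_instances \<epsilon>) k \<le> ennreal (r k)"
  \<comment> \<open>Any positive constant below 1/3 contradicts the ratio \<open>m / 3\<close> in
    the end.\<close>
  moreover have "\<forall>\<^sub>F k in sequentially. norm (r k) \<le> 1 / 4 * norm (ln (real k) / ln (ln (real k)))"
    by (rule landau_o.smallD[OF assms(3)]) simp
  ultimately have ev: "\<forall>\<^sub>F k in sequentially.
      competitive_ratio A (small_cardinality_instances \<epsilon>) k
        \<le> ennreal (\<bar>ln (real k) / ln (ln (real k))\<bar> / 4)"
    by eventually_elim (erule order_trans, auto intro!: ennreal_leI)
  \<comment> \<open>An eventual bound can be refuted along the sparsities \<open>k m\<close> alone,
    since they tend to infinity.\<close>
  define k where "k = (\<lambda>m. (m - 1) * m ^ (m - 1) :: nat)"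
  have k_ge: "m \<le> k m" if "3 \<le> m" for m
  proof -
    have "1 * m ^ 1 \<le> (m - 1) * m ^ (m - 1)"
      using that by (intro mult_le_mono power_increasing) auto
    then show ?thesis by (simp add: k_def)
  qed
  have "filterlim k at_top sequentially"
    using k_ge by (intro filterlim_at_top_mono[OF filterlim_ident])
      (auto simp: eventually_at_top_linorder)
  then have "\<forall>\<^sub>F m in sequentially. competitive_ratio A (small_cardinality_instances \<epsilon>) (k m)
        \<le> ennreal (\<bar>ln (real (k m)) / ln (ln (real (k m)))\<bar> / 4)"
    using ev by (rule eventually_compose_filterlim[rotated])
  \<comment> \<open>The right-hand side is \<open>ln (k m)\<close>, so this gives
    \<open>ln m \<le> ln (ln (k m))\<close>.\<close>
  moreover have "\<forall>\<^sub>F m in sequentially. real m \<le> ln (real m - 1) + (real m - 1) * ln (real m)"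
    by real_asymp
  ultimately have "\<forall>\<^sub>F m in sequentially. False"
    using eventually_ge_at_top[of 3]
  proof eventually_elim
    case (elim m)
    have ln_k: "ln (real (k m)) = ln (real m - 1) + (real m - 1) * ln (real m)"
      using elim(3) by (simp add: k_def ln_mult ln_realpow)
    have lower: "real m \<le> ln (real (k m))" using elim(2) ln_k by simp
    have "ln (real m - 1) \<le> ln (real m)" using elim(3) by simp
    then have upper: "ln (real (k m)) \<le> real m * ln (real m)"
      using ln_k by (simp add: algebra_simps)
    have "0 < ln (real m)" "ln (real m) \<le> ln (ln (real (k m)))"
      using elim(3) lower by auto
    \<comment> \<open>The numerator is at most \<open>m * ln m\<close> and the denominator at least
      \<open>ln m\<close>, so the logarithms cancel.\<close>
    then have "ln (real (k m)) / ln (ln (real (k m))) \<le> real m"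
      using upper by (simp add: divide_le_eq) (smt (verit) mult_left_mono of_nat_0_le_iff)
    moreover have "0 \<le> ln (real (k m)) / ln (ln (real (k m)))"
      using lower \<open>0 < ln (real m)\<close> \<open>ln (real m) \<le> ln (ln (real (k m)))\<close> by simp
    ultimately have "\<bar>ln (real (k m)) / ln (ln (real (k m)))\<bar> / 4 \<le> real m / 4"
      by simp
    note ennreal_leI[OF this]
    moreover have "ennreal (real m / 3)
        \<le> competitive_ratio A (small_cardinality_instances \<epsilon>) (k m)"
      unfolding k_def using elim(3) by (intro competitive_ratio_ge[OF assms(1,2)]) simp
    ultimately have "ennreal (real m / 3) \<le> ennreal (real m / 4)"
      using elim(1) by (meson order_trans)
    then show False using elim(3) by simp
  qed
  then show False by simp
qed

end
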